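(* Let $S$ be an MV-derived semiring and $n\geq 1$ an integer. Then: (i) $\mathbf{M}_n(S)$ is subdirectly irreducible if and only if $S$ has a least non-zero element, i.e. an element $e\in S$ with $e\neq 0$ and $e\leq x$ for every $x\in S\setminus\{0\}$. (ii) $\mathbf{M}_n(S)$ is congruence-simple if and only if $|S|=2$. Moreover, if $S$ is subdirectly irreducible, then $S$ is totally ordered.
   Context: A lattice-ordered group ($\ell$-group) $G(\ast,{}^{-1},0,\wedge,\vee)$ is a (not necessarily abelian) group $G(\ast,{}^{-1},0)$ with neutral element denoted $0$, together with a lattice structure $G(\wedge,\vee)$ such that $\ast$ distributes over $\vee$ and over $\wedge$ from both sides. For $u\in G$ with $u>0$, put $S=[0,u]=\{a\in G : 0\leq a\leq u\}$ and define $a\cdot b=(a\ast u^{-1}\ast b)\vee 0$ for $a,b\in S$. Then $S(\vee,\cdot)$ is an additively idempotent semiring (addition $\vee$) with zero $0$ and unity $u$, whose order is the restriction of the order of $G$; semirings arising in this way are called MV-derived. A semiring is a non-empty set with two associative binary operations $+,\cdot$ such that $+$ is commutative and $\cdot$ distributes over $+$ from both sides. A congruence on a semiring is an equivalence relation preserved under addition and multiplication. A semiring is congruence-simple if it has exactly two congruences, and subdirectly irreducible if there is a least (with respect to inclusion) congruence among its congruences different from the identity relation; in particular at least one such congruence exists. $\mathbf{M}_n(S)$ is the semiring of all $n\times n$ matrices over $S$ with the usual addition and multiplication: $(a_{ij})+(b_{ij})=(a_{ij}+b_{ij})$, $(a_{ij})(b_{ij})=(\sum_k a_{ik}b_{kj})$,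 where $+$ and $\sum$ refer to the addition of $S$. *)

theory Defs
  imports "Jordan_Normal_Form.Matrix"
begin

text \<open>
  As in \<^class>\<open>group_add\<close>, the group operation is written additively but need not be commutative.
\<close>

class lattice_group_add = group_add + lattice +
  assumes add_sup_left: "c + sup a b = sup (c + a) (c + b)"
    and add_sup_right: "sup a b + c = sup (a + c) (b + c)"
    and add_inf_left: "c + inf a b = inf (c + a) (c + b)"
    and add_inf_right: "inf a b + c = inf (a + c) (b + c)"

text \<open>
  Semirings are represented by the \<^type>\<open>ring\<close> records of HOL-Algebra. In a noncommutative group,
  \<^term>\<open>a - u + b\<close> is the product of \<open>a\<close>, the inverse of \<open>u\<close> and \<open>b\<close>, in this order.
\<close>

definition mv_semiring :: "'a::lattice_group_add \<Rightarrow> 'a ring" where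
  "mv_semiring u =
    \<lparr>carrier = {0..u}, monoid.mult = (\<lambda>a b. sup (a - u + b) 0), one = u, zero = 0, add = sup\<rparr>"

definition mv_derived :: "'a::lattice_group_add ring \<Rightarrow> bool" where
  "mv_derived S \<longleftrightarrow> (\<exists>u>0. S = mv_semiring u)"

definition mat_semiring :: "nat \<Rightarrow> 'a ring \<Rightarrow> 'a mat ring" where
  "mat_semiring n S =
    \<lparr>carrier = {A \<in> carrier_mat n n. \<forall>i<n. \<forall>j<n. A $$ (i, j) \<in> carrier S},
     monoid.mult = (\<lambda>A B. mat n n (\<lambda>(i, j). \<Oplus>\<^bsub>S\<^esub>k\<in>{..<n}. A $$ (i, k) \<otimes>\<^bsub>S\<^esub> B $$ (k, j))),
     one = mat n n (\<lambda>(i, j). if i = j then \<one>\<^bsub>S\<^esub> else \<zero>\<^bsub>S\<^esub>),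
     zero = mat n n (\<lambda>(i, j). \<zero>\<^bsub>S\<^esub>),
     add = (\<lambda>A B. mat n n (\<lambda>(i, j). A $$ (i, j) \<oplus>\<^bsub>S\<^esub> B $$ (i, j)))\<rparr>"

definition semiring_congruence :: "'a ring \<Rightarrow> ('a \<times> 'a) set \<Rightarrow> bool" where
  "semiring_congruence R r \<longleftrightarrow> equiv (carrier R) r \<and>
    (\<forall>a b c d. (a, b) \<in> r \<and> (c, d) \<in> r \<longrightarrow>
      (a \<oplus>\<^bsub>R\<^esub> c, b \<oplus>\<^bsub>R\<^esub> d) \<in> r \<and> (a \<otimes>\<^bsub>R\<^esub> c, b \<otimes>\<^bsub>R\<^esub> d) \<in> r)"

definition congruence_simple :: "'a ring \<Rightarrow> bool" where
  "congruence_simple R \<longleftrightarrow> card {r. semiring_congruence R r} = 2"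

definition subdirectly_irreducible :: "'a ring \<Rightarrow> bool" where
  "subdirectly_irreducible R \<longleftrightarrow>
    (\<exists>m. semiring_congruence R m \<and> m \<noteq> Id_on (carrier R) \<and>
      (\<forall>r. semiring_congruence R r \<and> r \<noteq> Id_on (carrier R) \<longrightarrow> m \<subseteq> r))"

text \<open>
  The sums over \<open>k\<close> in matrix products are well-behaved because the addition of an MV-derived
  semiring is a commutative monoid, as contained in the following lemma.
\<close>

lemma lattice_group_add_left_mono:
  fixes a b c :: "'a::lattice_group_add"
  assumes "a \<le> b" shows "c + a \<le> c + b"
  using assms add_sup_left[of c a b] by (metis sup.absorb_iff2)

lemma lattice_group_add_right_mono:
  fixes a b c :: "'a::lattice_group_add"
  assumes "a \<le> b" shows "a + c \<le> b + c"
  using assms add_sup_right[of a b c] by (metis sup.absorb_iff2)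

lemma semiring_mv_semiring:
  fixes u :: "'a::lattice_group_add"
  assumes u: "0 < u"
  shows "semiring (mv_semiring u)"
proof -
  have left0: "a - u \<le> 0" if "a \<le> u" for a
    using lattice_group_add_right_mono[OF that, of "- u"] by simp
  have right0: "- u + b \<le> 0" if "b \<le> u" for b
    using lattice_group_add_left_mono[OF that, of "- u"] by simp
  have right0': "c - u + b \<le> c" if "b \<le> u" for b c
    using lattice_group_add_left_mono[OF right0[OF that], of c]
    by (simp add: add.assoc[symmetric])
  have left0': "b - u + c \<le> c" if "b \<le> u" for b c
    using lattice_group_add_right_mono[OF left0[OF that], of c] by simp
  have assoc: "sup (sup (a - u + b) 0 - u + c) 0 = sup (a - u + sup (b - u + c) 0) 0"
    if "a \<le> u" "c \<le> u" for a b c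
  proof -
    have "sup (a - u + b) 0 - u + c = sup (a - u + b - u + c) (- u + c)"
      by (simp add: diff_conv_add_uminus add_sup_right add.assoc del: add_uminus_conv_diff)
    moreover have "a - u + sup (b - u + c) 0 = sup (a - u + b - u + c) (a - u)"
      by (simp add: diff_conv_add_uminus add_sup_left add.assoc del: add_uminus_conv_diff)
    ultimately show ?thesis
      using left0[OF that(1)] right0[OF that(2)] by (simp add: sup.assoc sup.absorb2)
  qed
  have distr: "sup (sup a b - u + c) 0 = sup (sup (a - u + c) 0) (sup (b - u + c) 0)"
    "sup (c - u + sup a b) 0 = sup (sup (c - u + a) 0) (sup (c - u + b) 0)" for a b c
    by (simp_all add: diff_conv_add_uminus add_sup_left add_sup_right sup_aci del: add_uminus_conv_diff)
  note ops = mv_semiring_def monoid.simps ring.simps partial_object.simps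
  show ?thesis
  proof (unfold_locales, goal_cases)
    case 8
    then show ?case by (simp only: ops atLeastAtMost_iff assoc)
  next
    case 12
    then show ?case by (simp only: ops distr)
  next
    case 13
    then show ?case by (simp only: ops distr)
  next
    case (7 a b)
    then show ?case using order_trans[OF right0'[of b a]] by (auto simp: ops)
  qed (use u in \<open>auto simp: mv_semiring_def sup_aci sup.absorb1 sup.absorb2 le_supI1 left0 right0\<close>)
qed

end

(*
  Since S has a zero and a unity, multiplying by matrix units shows that the congruences of the
  matrix semiring over S correspond, as an ordered set, to those of S; so n plays no role.
  In S the unity u is the greatest element, hence xy lies below x and y, and the kernel of the map
  x |-> sup x e is a congruence for every e. If it contains a pair (a, b) with a < b for all e other
  than 0, then a = 0 and b is the least non-zero element. Conversely, if a congruence relates a < b,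
  multiplying on the right by u - a shows that it relates 0 and b - a > 0, and hence also 0 and the
  least non-zero element, if there is one. Finally x - inf x y and y - inf x y have infimum 0, so
  one of them is 0 if S has a least non-zero element.
*)
theory Submission
  imports Defs
begin

section \<open>Congruences of semirings\<close>

lemma semiring_congruenceI:
  assumes "\<And>a b. (a, b) \<in> r \<Longrightarrow> a \<in> carrier R \<and> b \<in> carrier R"
    and "\<And>a. a \<in> carrier R \<Longrightarrow> (a, a) \<in> r"
    and "\<And>a b. (a, b) \<in> r \<Longrightarrow> (b, a) \<in> r"
    and "\<And>a b c. (a, b) \<in> r \<Longrightarrow> (b, c) \<in> r \<Longrightarrow> (a, c) \<in> r"
    and "\<And>a b c d. (a, b) \<in> r \<Longrightarrow> (c, d) \<in> r \<Longrightarrow> (a \<oplus>\<^bsub>R\<^esub> c, b \<oplus>\<^bsub>R\<^esub> d) \<in> r"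
    and "\<And>a b c d. (a, b) \<in> r \<Longrightarrow> (c, d) \<in> r \<Longrightarrow> (a \<otimes>\<^bsub>R\<^esub> c, b \<otimes>\<^bsub>R\<^esub> d) \<in> r"
  shows "semiring_congruence R r"
  unfolding semiring_congruence_def
proof (intro conjI equivI allI impI)
  show "r \<subseteq> carrier R \<times> carrier R" using assms(1) by auto
  show "refl_on (carrier R) r" using assms(2) by (auto simp: refl_on_def)
  show "sym r" using assms(3) by (auto intro: symI)
  show "trans r" using assms(4) by (blast intro: transI)
qed (use assms(5,6) in auto)

lemma
  assumes "semiring_congruence R r"
  shows semiring_congruence_subset: "r \<subseteq> carrier R \<times> carrier R"
    and semiring_congruence_refl: "a \<in> carrier R \<Longrightarrow> (a, a) \<in> r"
    and semiring_congruence_sym: "(a, b) \<in> r \<Longrightarrow> (b, a) \<in> r"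
    and semiring_congruence_trans: "(a, b) \<in> r \<Longrightarrow> (b, c) \<in> r \<Longrightarrow> (a, c) \<in> r"
    and semiring_congruence_add:
      "(a, b) \<in> r \<Longrightarrow> (c, d) \<in> r \<Longrightarrow> (a \<oplus>\<^bsub>R\<^esub> c, b \<oplus>\<^bsub>R\<^esub> d) \<in> r"
    and semiring_congruence_mult:
      "(a, b) \<in> r \<Longrightarrow> (c, d) \<in> r \<Longrightarrow> (a \<otimes>\<^bsub>R\<^esub> c, b \<otimes>\<^bsub>R\<^esub> d) \<in> r"
  using assms unfolding semiring_congruence_def equiv_def refl_on_def
  by (auto dest: symD transD)

lemma semiring_congruence_in_carrier:
  assumes "semiring_congruence R r" and "(a, b) \<in> r"
  shows "a \<in> carrier R" and "b \<in> carrier R"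
  using semiring_congruence_subset[OF assms(1)] assms(2) by auto

lemma semiring_congruence_neq_Id_on:
  assumes "semiring_congruence R r" and "r \<noteq> Id_on (carrier R)"
  obtains a b where "(a, b) \<in> r" and "a \<noteq> b"
proof -
  have "Id_on (carrier R) \<subseteq> r" using semiring_congruence_refl[OF assms(1)] by auto
  then obtain a b where "(a, b) \<in> r" "(a, b) \<notin> Id_on (carrier R)"
    using assms(2) by auto
  then show thesis
    using that semiring_congruence_subset[OF assms(1)] by (auto simp: Id_on_iff)
qed

context
  fixes S :: "'a ring"
  assumes S: "semiring S"
begin

interpretation semiring S by (rule S)

lemma semiring_congruence_Id_on: "semiring_congruence S (Id_on (carrier S))"
  by (rule semiring_congruenceI) (auto simp: Id_on_iff)

lemma semiring_congruence_Times: "semiring_congruence S (carrier S \<times> carrier S)"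
  by (rule semiring_congruenceI) auto

section \<open>Congruences and finite sums in a semiring\<close>

lemma semiring_congruence_finsum:
  assumes r: "semiring_congruence S r" and "finite T" and "\<And>k. k \<in> T \<Longrightarrow> (f k, g k) \<in> r"
  shows "(finsum S f T, finsum S g T) \<in> r"
  using assms(2,3)
proof (induction T rule: finite_induct)
  case empty
  then show ?case by (simp add: semiring_congruence_refl[OF r])
next
  case (insert x F)
  \<comment> \<open>Splitting off the summand at \<open>x\<close> requires all summands to lie in
    the carrier, which holds because \<open>r\<close> is a relation on it.\<close>
  have "f \<in> F \<rightarrow> carrier S" "g \<in> F \<rightarrow> carrier S" "f x \<in> carrier S" "g x \<in> carrier S"
    using insert.prems semiring_congruence_in_carrier[OF r] by blast+
  then show ?case
    using insert semiring_congruence_add[OF r] by simp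
qed

text \<open>In products with matrix units the sum over \<open>k\<close> collapses to one summand;
  this isolates that collapse.\<close>

lemma finsum_single:
  assumes "finite T" and "i \<in> T" and "f i \<in> carrier S" and "\<And>k. k \<in> T \<Longrightarrow> k \<noteq> i \<Longrightarrow> f k = \<zero>\<^bsub>S\<^esub>"
  shows "finsum S f T = f i"
proof -
  have "finsum S f T = finsum S (\<lambda>k. if i = k then f k else \<zero>\<^bsub>S\<^esub>) T"
    using assms by (intro finsum_cong') auto
  also have "\<dots> = f i"
  proof (rule add.finprod_singleton)
    show "f \<in> T \<rightarrow> carrier S" using assms(3,4) by (metis Pi_I zero_closed)
  qed (use assms in auto)
  finally show ?thesis .
qed

section \<open>Congruences of matrix semirings\<close>

text \<open>A scalar multiple of a matrix unit. For a position \<open>(i, j)\<close> out of range it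
  is the zero matrix.\<close>

definition mat_single :: "nat \<Rightarrow> nat \<Rightarrow> nat \<Rightarrow> 'a \<Rightarrow> 'a mat" where
  "mat_single n i j a = mat n n (\<lambda>p. if p = (i, j) then a else \<zero>\<^bsub>S\<^esub>)"

text \<open>The carrier conditions fix the dimensions, which the entries at indices below
  \<open>n\<close> do not determine.\<close>

definition mat_congruence :: "nat \<Rightarrow> ('a \<times> 'a) set \<Rightarrow> ('a mat \<times> 'a mat) set" where
  "mat_congruence n r = {(A, B). A \<in> carrier (mat_semiring n S) \<and> B \<in> carrier (mat_semiring n S) \<and>
    (\<forall>i<n. \<forall>j<n. (A $$ (i, j), B $$ (i, j)) \<in> r)}"

section \<open>Arithmetic of matrix units\<close>

lemma mat_single_carrier [simp]:
  "a \<in> carrier S \<Longrightarrow> mat_single n i j a \<in> carrier (mat_semiring n S)"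
  by (auto simp: mat_single_def mat_semiring_def)

lemma mat_semiring_eqI:
  assumes "A \<in> carrier (mat_semiring n S)" and "B \<in> carrier (mat_semiring n S)"
    and "\<And>i j. i < n \<Longrightarrow> j < n \<Longrightarrow> A $$ (i, j) = B $$ (i, j)"
  shows "A = B"
  using assms by (intro eq_matI) (auto simp: mat_semiring_def)

text \<open>Only the summand at \<open>p\<close> can be non-zero, so row \<open>p\<close> of
  \<open>A\<close> is moved to row \<open>i\<close>, scaled by \<open>a\<close>, and all else is
  cleared.\<close>

lemma mat_single_mult:
  assumes A: "A \<in> carrier (mat_semiring n S)" and a: "a \<in> carrier S" and p: "p < n"
  shows "mat_single n i p a \<otimes>\<^bsub>mat_semiring n S\<^esub> A =
    mat n n (\<lambda>(k, l). if k = i then a \<otimes>\<^bsub>S\<^esub> A $$ (p, l) else \<zero>\<^bsub>S\<^esub>)"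
proof (rule eq_matI; simp add: mat_semiring_def)
  fix k l assume kl: "k < n" "l < n"
  have "finsum S (\<lambda>ka. mat_single n i p a $$ (k, ka) \<otimes>\<^bsub>S\<^esub> A $$ (ka, l)) {..<n}
    = mat_single n i p a $$ (k, p) \<otimes>\<^bsub>S\<^esub> A $$ (p, l)"
    using A a p kl by (intro finsum_single) (auto simp: mat_single_def mat_semiring_def)
  \<comment> \<open>The two implications are the goal as the simplifier leaves it after splitting
    the conditional.\<close>
  then show "(k = i \<longrightarrow> finsum S (\<lambda>ka. mat_single n i p a $$ (i, ka) \<otimes>\<^bsub>S\<^esub> A $$ (ka, l)) {..<n}
      = a \<otimes>\<^bsub>S\<^esub> A $$ (p, l)) \<and>
    (k \<noteq> i \<longrightarrow> finsum S (\<lambda>ka. mat_single n i p a $$ (k, ka) \<otimes>\<^bsub>S\<^esub> A $$ (ka, l)) {..<n} = \<zero>\<^bsub>S\<^esub>)"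
    using A a p kl by (auto simp: mat_single_def mat_semiring_def)
qed

text \<open>Mirror image for columns: column \<open>q\<close> moves to column
  \<open>j\<close>.\<close>

lemma mult_mat_single:
  assumes A: "A \<in> carrier (mat_semiring n S)" and a: "a \<in> carrier S" and q: "q < n"
  shows "A \<otimes>\<^bsub>mat_semiring n S\<^esub> mat_single n q j a =
    mat n n (\<lambda>(k, l). if l = j then A $$ (k, q) \<otimes>\<^bsub>S\<^esub> a else \<zero>\<^bsub>S\<^esub>)"
proof (rule eq_matI; simp add: mat_semiring_def)
  fix k l assume kl: "k < n" "l < n"
  have "finsum S (\<lambda>ka. A $$ (k, ka) \<otimes>\<^bsub>S\<^esub> mat_single n q j a $$ (ka, l)) {..<n}
    = A $$ (k, q) \<otimes>\<^bsub>S\<^esub> mat_single n q j a $$ (q, l)"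
    using A a q kl by (intro finsum_single) (auto simp: mat_single_def mat_semiring_def)
  then show "(l = j \<longrightarrow> finsum S (\<lambda>ka. A $$ (k, ka) \<otimes>\<^bsub>S\<^esub> mat_single n q j a $$ (ka, j)) {..<n}
      = A $$ (k, q) \<otimes>\<^bsub>S\<^esub> a) \<and>
    (l \<noteq> j \<longrightarrow> finsum S (\<lambda>ka. A $$ (k, ka) \<otimes>\<^bsub>S\<^esub> mat_single n q j a $$ (ka, l)) {..<n} = \<zero>\<^bsub>S\<^esub>)"
    using A a q kl by (auto simp: mat_single_def mat_semiring_def)
qed

lemma mat_single_mult_mat_single:
  assumes "a \<in> carrier S" and "b \<in> carrier S" and "p < n"
  shows "mat_single n i p a \<otimes>\<^bsub>mat_semiring n S\<^esub> mat_single n p j b = mat_single n i j (a \<otimes>\<^bsub>S\<^esub> b)"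
  using assms mat_single_mult[OF mat_single_carrier[of b] assms(1,3)]
  by (auto intro!: eq_matI simp: mat_single_def)

text \<open>The left factor selects row \<open>p\<close> and the right factor column
  \<open>q\<close>, so a single entry can be moved to any position.\<close>

lemma mat_single_mult_mult_mat_single:
  assumes A: "A \<in> carrier (mat_semiring n S)" and p: "p < n" and q: "q < n"
  shows "mat_single n i p \<one>\<^bsub>S\<^esub> \<otimes>\<^bsub>mat_semiring n S\<^esub> A \<otimes>\<^bsub>mat_semiring n S\<^esub> mat_single n q j \<one>\<^bsub>S\<^esub>
    = mat_single n i j (A $$ (p, q))"
proof -
  \<comment> \<open>The inner product must be known to lie in the carrier before
    \<open>mult_mat_single\<close> applies to it.\<close>
  have "mat n n (\<lambda>(k, l). if k = i then \<one>\<^bsub>S\<^esub> \<otimes>\<^bsub>S\<^esub> A $$ (p, l) else \<zero>\<^bsub>S\<^esub>)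
      \<in> carrier (mat_semiring n S)"
    using A p by (auto simp: mat_semiring_def)
  then show ?thesis
    using A p q by (simp add: mat_single_mult mult_mat_single)
      (auto intro!: eq_matI simp: mat_single_def mat_semiring_def)
qed

lemma mat_single_add_mat_single:
  assumes "a \<in> carrier S" and "b \<in> carrier S"
  shows "mat_single n i j a \<oplus>\<^bsub>mat_semiring n S\<^esub> mat_single n i j b = mat_single n i j (a \<oplus>\<^bsub>S\<^esub> b)"
  using assms by (auto intro!: eq_matI simp: mat_single_def mat_semiring_def)

section \<open>Correspondence between congruences of \<open>S\<close> and of its matrix
  semiring\<close>

lemma mat_single_in_mat_congruence_iff:
  assumes "a \<in> carrier S" and "b \<in> carrier S" and r: "semiring_congruence S r" and "i < n" and "j < n"
  shows "(mat_single n i j a, mat_single n i j b) \<in> mat_congruence n r \<longleftrightarrow> (a, b) \<in> r"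
  using assms semiring_congruence_refl[OF r]
  by (auto simp: mat_congruence_def mat_single_def mat_semiring_def)

text \<open>Entries of sums and products are built from the given entries by finite sums and
  products in \<open>S\<close>, all of which respect \<open>r\<close>.\<close>

lemma semiring_congruence_mat_congruence:
  assumes r: "semiring_congruence S r"
  shows "semiring_congruence (mat_semiring n S) (mat_congruence n r)"
proof (rule semiring_congruenceI, goal_cases)
  case (6 A B C D)
  then have "(A $$ (i, k) \<otimes>\<^bsub>S\<^esub> C $$ (k, j), B $$ (i, k) \<otimes>\<^bsub>S\<^esub> D $$ (k, j)) \<in> r"
    if "i < n" "j < n" "k < n" for i j k
    using that by (auto simp: mat_congruence_def intro: semiring_congruence_mult[OF r])
  then have sum: "(finsum S (\<lambda>k. A $$ (i, k) \<otimes>\<^bsub>S\<^esub> C $$ (k, j)) {..<n},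
      finsum S (\<lambda>k. B $$ (i, k) \<otimes>\<^bsub>S\<^esub> D $$ (k, j)) {..<n}) \<in> r"
    if "i < n" "j < n" for i j
    using that by (intro semiring_congruence_finsum[OF r]) auto
  show ?case
    using sum semiring_congruence_in_carrier[OF r sum]
    by (auto simp: mat_congruence_def mat_semiring_def)
next
  case (5 A B C D)
  then have add: "(A $$ (i, j) \<oplus>\<^bsub>S\<^esub> C $$ (i, j), B $$ (i, j) \<oplus>\<^bsub>S\<^esub> D $$ (i, j)) \<in> r"
    if "i < n" "j < n" for i j
    using that by (auto simp: mat_congruence_def intro: semiring_congruence_add[OF r])
  show ?case
    using add semiring_congruence_in_carrier[OF r add]
    by (auto simp: mat_congruence_def mat_semiring_def)
next
  case (4 A B C)
  then show ?case
    using semiring_congruence_trans[OF r] unfolding mat_congruence_def by blast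
next
  case (2 A)
  then show ?case
    using semiring_congruence_refl[OF r] by (auto simp: mat_congruence_def mat_semiring_def)
qed (auto simp: mat_congruence_def intro: semiring_congruence_sym[OF r])

text \<open>Matrix units move entries between positions, and a matrix is the sum of its single-entry
  matrices, so \<open>r\<close> is determined by what it does at one position.\<close>

lemma mat_congruence_surj:
  assumes r: "semiring_congruence (mat_semiring n S) r" and n: "0 < n"
  obtains s where "semiring_congruence S s" and "mat_congruence n s = r"
proof
  \<comment> \<open>The corner \<open>(0, 0)\<close> exists because \<open>0 < n\<close>; matrices
    supported there form a copy of \<open>S\<close> under addition and multiplication.\<close>
  define s where "s = {(a, b). a \<in> carrier S \<and> b \<in> carrier S \<and>
    (mat_single n 0 0 a, mat_single n 0 0 b) \<in> r}"
  show "semiring_congruence S s"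
  proof (rule semiring_congruenceI, goal_cases)
    case (5 a b c d)
    then show ?case
      using semiring_congruence_add[OF r, of "mat_single n 0 0 a" "mat_single n 0 0 b"
          "mat_single n 0 0 c" "mat_single n 0 0 d"]
      by (simp add: s_def mat_single_add_mat_single)
  next
    case (6 a b c d)
    then show ?case
      using semiring_congruence_mult[OF r, of "mat_single n 0 0 a" "mat_single n 0 0 b"
          "mat_single n 0 0 c" "mat_single n 0 0 d"] n
      by (simp add: s_def mat_single_mult_mat_single)
  next
    case (4 a b c)
    then show ?case using semiring_congruence_trans[OF r] unfolding s_def by blast
  qed (auto simp: s_def semiring_congruence_refl[OF r] intro: semiring_congruence_sym[OF r])
  \<comment> \<open>The pair \<open>(A, B)\<close> is multiplied by matrix units on both sides, each
    of which is related to itself.\<close>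
  have transport: "(mat_single n i j (A $$ (p, q)), mat_single n i j (B $$ (p, q))) \<in> r"
    if AB: "(A, B) \<in> r" and "p < n" "q < n" for A B i j p q
    using semiring_congruence_mult[OF r semiring_congruence_mult[OF r
          semiring_congruence_refl[OF r mat_single_carrier[OF one_closed]] AB]
          semiring_congruence_refl[OF r mat_single_carrier[OF one_closed]],
          of i p q j]
      semiring_congruence_in_carrier[OF r AB] that(2,3)
    by (simp add: mat_single_mult_mult_mat_single)
  show "mat_congruence n s = r"
  proof (intro equalityI subsetI)
    fix x assume "x \<in> mat_congruence n s"
    then obtain A B where x: "x = (A, B)" and A: "A \<in> carrier (mat_semiring n S)"
      and B: "B \<in> carrier (mat_semiring n S)"
      and AB: "\<And>i j. i < n \<Longrightarrow> j < n \<Longrightarrow> (A $$ (i, j), B $$ (i, j)) \<in> s"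
      by (auto simp: mat_congruence_def)
    \<comment> \<open>The definition of \<open>s\<close> speaks of the corner only;
      \<open>transport\<close> carries its pairs to position \<open>(i, j)\<close>.\<close>
    have single: "(mat_single n i j (A $$ (i, j)), mat_single n i j (B $$ (i, j))) \<in> r"
      if "i < n" "j < n" for i j
      using transport[of "mat_single n 0 0 (A $$ (i, j))" "mat_single n 0 0 (B $$ (i, j))" 0 0 i j]
        AB[OF that] n
      by (simp add: s_def) (simp add: mat_single_def)
    \<comment> \<open>\<open>M\<close> cut down to the positions in \<open>T\<close>. Induction on
      \<open>T\<close> reassembles \<open>M\<close> with binary additions only, so no semiring laws
      for the matrices are used.\<close>
    define part where "part T M = mat n n (\<lambda>p. if p \<in> T then M $$ p else \<zero>\<^bsub>S\<^esub>)" for T and M :: "'a mat"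
    \<comment> \<open>The position must be new: addition in \<open>S\<close> is not assumed
      idempotent here, so the entry must not be added twice.\<close>
    have part_insert: "part (insert (i, j) T) M =
        part T M \<oplus>\<^bsub>mat_semiring n S\<^esub> mat_single n i j (M $$ (i, j))"
      if "(i, j) \<notin> T" "M \<in> carrier (mat_semiring n S)" for i j T M
      using that by (auto intro!: eq_matI simp: part_def mat_single_def mat_semiring_def)
    have "(part T A, part T B) \<in> r" if "finite T" "T \<subseteq> {..<n} \<times> {..<n}" for T
      using that
    proof (induction T rule: finite_induct)
      case empty
      have "part {} A \<in> carrier (mat_semiring n S)" by (simp add: part_def mat_semiring_def)
      then show ?case using semiring_congruence_refl[OF r] by (simp add: part_def)
    next
      case (insert p T)
      then show ?case
        using A B part_insert single
        by (cases p) (auto intro: semiring_congruence_add[OF r])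
    qed
    then have "(part ({..<n} \<times> {..<n}) A, part ({..<n} \<times> {..<n}) B) \<in> r" by simp
    moreover have "part ({..<n} \<times> {..<n}) M = M" if "M \<in> carrier (mat_semiring n S)" for M
      using that by (auto intro!: eq_matI simp: part_def mat_semiring_def)
    ultimately show "x \<in> r" using x A B by simp
  next
    fix x assume "x \<in> r"
    then obtain A B where x: "x = (A, B)" and AB: "(A, B) \<in> r" by (cases x) auto
    show "x \<in> mat_congruence n s"
      using transport[OF AB] semiring_congruence_in_carrier[OF r AB]
      by (auto simp: x mat_congruence_def s_def mat_semiring_def)
  qed
qed

text \<open>Inclusion is tested on single-entry matrices at the corner. Together with surjectivity,
  this makes \<open>mat_congruence n\<close> an order isomorphism.\<close>

lemma mat_congruence_subset_iff:
  assumes r: "semiring_congruence S r" and s: "semiring_congruence S s" and n: "0 < n"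
  shows "mat_congruence n r \<subseteq> mat_congruence n s \<longleftrightarrow> r \<subseteq> s"
proof
  assume sub: "mat_congruence n r \<subseteq> mat_congruence n s"
  show "r \<subseteq> s"
  proof (rule subrelI)
    fix a b assume ab: "(a, b) \<in> r"
    note car = semiring_congruence_in_carrier[OF r ab]
    show "(a, b) \<in> s"
      using sub mat_single_in_mat_congruence_iff[OF car r n n]
        mat_single_in_mat_congruence_iff[OF car s n n] ab by blast
  qed
qed (auto simp: mat_congruence_def)

lemma bij_betw_mat_congruence:
  assumes n: "0 < n"
  shows "bij_betw (mat_congruence n) {r. semiring_congruence S r}
    {r. semiring_congruence (mat_semiring n S) r}"
proof (rule bij_betw_imageI)
  show "inj_on (mat_congruence n) {r. semiring_congruence S r}"
    using mat_congruence_subset_iff[OF _ _ n] by (intro inj_onI) (simp add: set_eq_subset)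
  show "mat_congruence n ` {r. semiring_congruence S r} = {r. semiring_congruence (mat_semiring n S) r}"
    using semiring_congruence_mat_congruence mat_congruence_surj[OF _ n] by blast
qed

section \<open>Transfer of simplicity and subdirect irreducibility\<close>

lemma congruence_simple_mat_semiring_iff:
  "0 < n \<Longrightarrow> congruence_simple (mat_semiring n S) \<longleftrightarrow> congruence_simple S"
  using bij_betw_same_card[OF bij_betw_mat_congruence] by (simp add: congruence_simple_def)

lemma mat_congruence_Id_on:
  "mat_congruence n (Id_on (carrier S)) = Id_on (carrier (mat_semiring n S))"
proof -
  have "A = B" if "(A, B) \<in> mat_congruence n (Id_on (carrier S))" for A B
    using that by (intro mat_semiring_eqI[of A n B]) (auto simp: mat_congruence_def Id_on_iff)
  then show ?thesis
    by (auto simp: mat_congruence_def mat_semiring_def Id_on_iff)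
qed

text \<open>Subdirect irreducibility speaks only of inclusion among congruences and of the identity,
  both of which \<open>mat_congruence n\<close> respects.\<close>

lemma subdirectly_irreducible_mat_semiring_iff:
  assumes n: "0 < n"
  shows "subdirectly_irreducible (mat_semiring n S) \<longleftrightarrow> subdirectly_irreducible S"
proof -
  define \<C> where "\<C> = {r. semiring_congruence S r}"
  have image: "{r. semiring_congruence (mat_semiring n S) r} = mat_congruence n ` \<C>"
    and inj: "inj_on (mat_congruence n) \<C>"
    using bij_betw_mat_congruence[OF n] by (auto simp: bij_betw_def \<C>_def)
  have neq: "mat_congruence n r \<noteq> Id_on (carrier (mat_semiring n S)) \<longleftrightarrow> r \<noteq> Id_on (carrier S)"
    if "r \<in> \<C>" for r
    using inj_on_eq_iff[OF inj that, of "Id_on (carrier S)"] semiring_congruence_Id_on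
    by (simp add: \<C>_def mat_congruence_Id_on)
  have sub: "mat_congruence n r \<subseteq> mat_congruence n s \<longleftrightarrow> r \<subseteq> s" if "r \<in> \<C>" "s \<in> \<C>" for r s
    using mat_congruence_subset_iff[OF _ _ n] that by (simp add: \<C>_def)
  have "subdirectly_irreducible (mat_semiring n S) \<longleftrightarrow>
    (\<exists>m \<in> mat_congruence n ` \<C>. m \<noteq> Id_on (carrier (mat_semiring n S)) \<and>
      (\<forall>r \<in> mat_congruence n ` \<C>. r \<noteq> Id_on (carrier (mat_semiring n S)) \<longrightarrow> m \<subseteq> r))"
    unfolding subdirectly_irreducible_def image[symmetric] by blast
  also have "\<dots> \<longleftrightarrow> (\<exists>m\<in>\<C>. m \<noteq> Id_on (carrier S) \<and> (\<forall>r\<in>\<C>. r \<noteq> Id_on (carrier S) \<longrightarrow> m \<subseteq> r))"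
    using neq sub by simp
  also have "\<dots> \<longleftrightarrow> subdirectly_irreducible S"
    unfolding subdirectly_irreducible_def \<C>_def by blast
  finally show ?thesis .
qed

text \<open>The intersection of all non-identity congruences is a congruence; a common pair
  \<open>(x, y)\<close> keeps it from being the identity, so it is the least one.\<close>

lemma subdirectly_irreducibleI:
  assumes xy: "x \<in> carrier S" "y \<in> carrier S" "x \<noteq> y"
    and least: "\<And>r. semiring_congruence S r \<Longrightarrow> r \<noteq> Id_on (carrier S) \<Longrightarrow> (x, y) \<in> r"
  shows "subdirectly_irreducible S"
proof -
  define m where "m = \<Inter>{r. semiring_congruence S r \<and> r \<noteq> Id_on (carrier S)}"
  have mem: "p \<in> m \<longleftrightarrow> (\<forall>r. semiring_congruence S r \<longrightarrow> r \<noteq> Id_on (carrier S) \<longrightarrow> p \<in> r)" for p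
    unfolding m_def by blast
  \<comment> \<open>The full relation is thus among the intersected congruences, which confines
    \<open>m\<close> to the carrier.\<close>
  have "(x, y) \<in> carrier S \<times> carrier S" "(x, y) \<notin> Id_on (carrier S)"
    using xy by (simp_all add: Id_on_iff)
  then have neq: "carrier S \<times> carrier S \<noteq> Id_on (carrier S)" by metis
  have "semiring_congruence S m"
  proof (rule semiring_congruenceI, goal_cases)
    case (1 a b)
    then show ?case using mem semiring_congruence_Times neq by blast
  next
    case (2 a)
    then show ?case using semiring_congruence_refl[of S] unfolding mem by blast
  next
    case (3 a b)
    then show ?case using semiring_congruence_sym[of S] unfolding mem by blast
  next
    case (4 a b c)
    then show ?case using semiring_congruence_trans[of S] unfolding mem by blast
  next
    case (5 a b c d)
    then show ?case using semiring_congruence_add[of S] unfolding mem by blast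
  next
    case (6 a b c d)
    then show ?case using semiring_congruence_mult[of S] unfolding mem by blast
  qed
  moreover have "(x, y) \<in> m" unfolding mem using least by blast
  then have "m \<noteq> Id_on (carrier S)" using xy(3) by (auto simp: Id_on_iff)
  moreover have "m \<subseteq> r" if "semiring_congruence S r" "r \<noteq> Id_on (carrier S)" for r
    unfolding m_def using that by blast
  ultimately show ?thesis
    unfolding subdirectly_irreducible_def by blast
qed

end

section \<open>Congruences of MV-derived semirings\<close>

context
  fixes u :: "'a::lattice_group_add"
  assumes u: "0 < u"
begin

lemmas mv_ops = mv_semiring_def monoid.simps ring.simps partial_object.simps

lemma mv_carrier: "carrier (mv_semiring u) = {0..u}"
  by (simp add: mv_semiring_def)

section \<open>Kernels of joining with a fixed element\<close>

text \<open>Translate \<open>b \<le> u\<close> by \<open>a - u\<close> on the left and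
  \<open>a \<le> u\<close> by \<open>- u + b\<close> on the right; the join with 0 respects the
  bounds, since \<open>a\<close> and \<open>b\<close> are non-negative.\<close>

lemma mv_mult_le:
  assumes "a \<in> {0..u}" and "b \<in> {0..u}"
  shows "a \<otimes>\<^bsub>mv_semiring u\<^esub> b \<le> a" and "a \<otimes>\<^bsub>mv_semiring u\<^esub> b \<le> b"
proof -
  have "a - u + b \<le> a"
    using lattice_group_add_left_mono[of b u "a - u"] assms by simp
  then show "a \<otimes>\<^bsub>mv_semiring u\<^esub> b \<le> a" using assms by (simp add: mv_ops)
  have "a - u + b \<le> b"
    using lattice_group_add_right_mono[of a u "- u + b"] assms
    by (simp add: add.assoc[symmetric])
  then show "a \<otimes>\<^bsub>mv_semiring u\<^esub> b \<le> b" using assms by (simp add: mv_ops)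
qed

text \<open>A product with factor \<open>e\<close> lies below \<open>e\<close>, so after
  distributing it is absorbed by the join with \<open>e\<close>.\<close>

lemma semiring_congruence_sup:
  assumes e: "e \<in> {0..u}"
  shows "semiring_congruence (mv_semiring u) {(x, y). x \<in> {0..u} \<and> y \<in> {0..u} \<and> sup x e = sup y e}"
    (is "semiring_congruence ?S ?r")
proof -
  interpret semiring ?S by (rule semiring_mv_semiring[OF u])
  have mult_right: "sup (sup x e \<otimes>\<^bsub>?S\<^esub> c) e = sup (x \<otimes>\<^bsub>?S\<^esub> c) e"
    and mult_left: "sup (c \<otimes>\<^bsub>?S\<^esub> sup x e) e = sup (c \<otimes>\<^bsub>?S\<^esub> x) e"
    if "x \<in> {0..u}" "c \<in> {0..u}" for x c
  proof -
    have add: "a \<oplus>\<^bsub>?S\<^esub> b = sup a b" for a b by (simp add: mv_semiring_def)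
    have "sup x e \<otimes>\<^bsub>?S\<^esub> c = sup (x \<otimes>\<^bsub>?S\<^esub> c) (e \<otimes>\<^bsub>?S\<^esub> c)"
      "c \<otimes>\<^bsub>?S\<^esub> sup x e = sup (c \<otimes>\<^bsub>?S\<^esub> x) (c \<otimes>\<^bsub>?S\<^esub> e)"
      using l_distr[of x e c] r_distr[of x e c] that e unfolding mv_carrier add by blast+
    then show "sup (sup x e \<otimes>\<^bsub>?S\<^esub> c) e = sup (x \<otimes>\<^bsub>?S\<^esub> c) e"
      "sup (c \<otimes>\<^bsub>?S\<^esub> sup x e) e = sup (c \<otimes>\<^bsub>?S\<^esub> x) e"
      using mv_mult_le(1)[OF e that(2)] mv_mult_le(2)[OF that(2) e]
      by (simp_all add: sup_assoc sup.absorb2)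
  qed
  show ?thesis
  proof (rule semiring_congruenceI, goal_cases)
    case (5 a b c d)
    have "sup (sup x y) e = sup (sup x e) (sup y e)" for x y by (simp add: sup_aci)
    then show ?case
      using 5 a_closed[of a c] a_closed[of b d] by (simp add: mv_semiring_def)
  next
    case (6 a b c d)
    \<comment> \<open>One factor is exchanged at a time.\<close>
    then have "sup (a \<otimes>\<^bsub>?S\<^esub> c) e = sup (b \<otimes>\<^bsub>?S\<^esub> c) e"
      using mult_right[of a c] mult_right[of b c] by simp
    also have "\<dots> = sup (b \<otimes>\<^bsub>?S\<^esub> d) e"
      using 6 mult_left[of c b] mult_left[of d b] by simp
    finally show ?case
      using 6 m_closed[of a c] m_closed[of b d] by (simp add: mv_carrier)
  qed (auto simp: mv_carrier)
qed

text \<open>The pair \<open>(0, e)\<close> is a witness, as both joins equal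
  \<open>e\<close>.\<close>

lemma semiring_congruence_sup_neq_Id_on:
  assumes "e \<in> {0..u}" and "e \<noteq> 0"
  shows "{(x, y). x \<in> {0..u} \<and> y \<in> {0..u} \<and> sup x e = sup y e} \<noteq> Id_on (carrier (mv_semiring u))"
proof
  assume eq: "{(x, y). x \<in> {0..u} \<and> y \<in> {0..u} \<and> sup x e = sup y e} = Id_on (carrier (mv_semiring u))"
  have "(0, e) \<in> {(x, y). x \<in> {0..u} \<and> y \<in> {0..u} \<and> sup x e = sup y e}"
    using assms u by (auto simp: sup.absorb2)
  then show False using assms(2) unfolding eq by (simp add: Id_on_iff)
qed

section \<open>Pairs found in every non-identity congruence\<close>

text \<open>Two related elements may be incomparable, but both are related to their join, and at
  least one lies strictly below it.\<close>

lemma mv_congruence_less: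
  assumes r: "semiring_congruence (mv_semiring u) r" and "r \<noteq> Id_on (carrier (mv_semiring u))"
  obtains a b where "(a, b) \<in> r" and "a < b"
proof -
  obtain a b where ab: "(a, b) \<in> r" "a \<noteq> b"
    using semiring_congruence_neq_Id_on[OF assms] .
  note car = semiring_congruence_in_carrier[OF r ab(1)]
  have "(a, sup a b) \<in> r" "(b, sup a b) \<in> r"
    using semiring_congruence_add[OF r semiring_congruence_refl[OF r car(1)] ab(1)]
      semiring_congruence_add[OF r semiring_congruence_sym[OF r ab(1)] semiring_congruence_refl[OF r car(2)]]
    by (simp_all add: mv_semiring_def sup_commute)
  moreover have "a < sup a b \<or> b < sup a b" using ab(2)
    by (metis less_le sup.cobounded1 sup.cobounded2)
  ultimately show thesis using that by blast
qed

lemma mv_congruence_zero: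
  assumes r: "semiring_congruence (mv_semiring u) r" and "r \<noteq> Id_on (carrier (mv_semiring u))"
  obtains d where "(0, d) \<in> r" and "d \<noteq> 0"
proof -
  obtain a b where ab: "(a, b) \<in> r" "a < b"
    using mv_congruence_less[OF assms] .
  have a: "0 \<le> a" "a \<le> u"
    using semiring_congruence_in_carrier[OF r ab(1)] by (simp_all add: mv_carrier)
  have "0 \<le> u - a" using lattice_group_add_right_mono[OF a(2), of "- a"] by simp
  moreover have "u - a \<le> u"
    using lattice_group_add_left_mono[OF a(1), of "u - a"] by simp
  ultimately have c: "u - a \<in> carrier (mv_semiring u)" by (simp add: mv_carrier)
  have d: "0 \<le> b - a" using lattice_group_add_right_mono[of a b "- a"] ab(2) by simp
  have "(a \<otimes>\<^bsub>mv_semiring u\<^esub> (u - a), b \<otimes>\<^bsub>mv_semiring u\<^esub> (u - a)) \<in> r"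
    using semiring_congruence_mult[OF r ab(1) semiring_congruence_refl[OF r c]] .
  \<comment> \<open>So right multiplication by \<open>u - a\<close> is \<open>x - a\<close>
    truncated at 0; it sends \<open>a\<close> to 0 and \<open>b\<close> to
    \<open>b - a\<close>.\<close>
  moreover have "x - u + (u - a) = x - a" for x
    by (simp add: diff_conv_add_uminus add.assoc del: add_uminus_conv_diff)
  ultimately have "(0, b - a) \<in> r"
    using d by (simp add: mv_ops sup.absorb1)
  moreover have "b - a \<noteq> 0" using ab(2) by auto
  ultimately show thesis using that by blast
qed

section \<open>The two criteria and total order\<close>

lemma mv_subdirectly_irreducible_iff:
  "subdirectly_irreducible (mv_semiring u) \<longleftrightarrow>
    (\<exists>e\<in>{0..u}. e \<noteq> 0 \<and> (\<forall>x\<in>{0..u} - {0}. e \<le> x))"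
proof
  assume "subdirectly_irreducible (mv_semiring u)"
  then obtain m where m: "semiring_congruence (mv_semiring u) m" "m \<noteq> Id_on (carrier (mv_semiring u))"
    and least: "\<And>r. semiring_congruence (mv_semiring u) r \<Longrightarrow> r \<noteq> Id_on (carrier (mv_semiring u)) \<Longrightarrow> m \<subseteq> r"
    unfolding subdirectly_irreducible_def by blast
  obtain a b where ab: "(a, b) \<in> m" "a < b"
    using mv_congruence_less[OF m] .
  have car: "a \<in> {0..u}" "b \<in> {0..u}"
    using semiring_congruence_in_carrier[OF m(1) ab(1)] by (simp_all only: mv_carrier)
  \<comment> \<open>The least congruence \<open>m\<close> is contained in the kernel of joining with
    any non-zero \<open>e\<close>.\<close>
  have sup: "sup a e = sup b e" if "e \<in> {0..u} - {0}" for e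
    using subsetD[OF least[OF semiring_congruence_sup semiring_congruence_sup_neq_Id_on] ab(1)] that
    by auto
  have "a = 0"
  proof (rule ccontr)
    assume "a \<noteq> 0"
    \<comment> \<open>The kernel for \<open>a\<close> itself would identify \<open>a\<close> with
      the strictly larger \<open>b\<close>.\<close>
    then have "sup a a = sup b a" using sup[of a] car by simp
    then show False using ab(2) sup.absorb1[OF less_imp_le[OF ab(2)]] by simp
  qed
  have "b \<le> e" if e: "e \<in> {0..u} - {0}" for e
  proof -
    have "sup 0 e = e" using e by (simp add: sup.absorb2)
    then show ?thesis using sup[OF e] \<open>a = 0\<close> by (metis sup.cobounded1)
  qed
  then show "\<exists>e\<in>{0..u}. e \<noteq> 0 \<and> (\<forall>x\<in>{0..u} - {0}. e \<le> x)"
    using car ab(2) \<open>a = 0\<close> by (intro bexI[of _ b]) auto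
next
  assume "\<exists>e\<in>{0..u}. e \<noteq> 0 \<and> (\<forall>x\<in>{0..u} - {0}. e \<le> x)"
  then obtain e where e: "e \<in> {0..u}" "e \<noteq> 0" and least: "\<And>x. x \<in> {0..u} \<Longrightarrow> x \<noteq> 0 \<Longrightarrow> e \<le> x"
    by blast
  show "subdirectly_irreducible (mv_semiring u)"
  proof (rule subdirectly_irreducibleI[OF semiring_mv_semiring[OF u]])
    fix r assume r: "semiring_congruence (mv_semiring u) r" "r \<noteq> Id_on (carrier (mv_semiring u))"
    obtain d where d: "(0, d) \<in> r" "d \<noteq> 0"
      using mv_congruence_zero[OF r] .
    have "e \<le> d"
      using least d semiring_congruence_in_carrier[OF r(1) d(1)] by (simp add: mv_carrier)
    \<comment> \<open>Joining the pair \<open>(0, d)\<close> with \<open>e\<close> gives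
      \<open>(e, d)\<close>, so 0 and \<open>e\<close> are linked through \<open>d\<close>.\<close>
    moreover have "(sup e 0, sup e d) \<in> r"
      using semiring_congruence_add[OF r(1) semiring_congruence_refl[OF r(1), of e] d(1)] e
      by (simp add: mv_ops)
    ultimately have "(e, d) \<in> r" using e by (simp add: sup.absorb1 sup.absorb2)
    then show "(0, e) \<in> r"
      using semiring_congruence_trans[OF r(1) d(1) semiring_congruence_sym[OF r(1)]] by simp
  qed (use e u in \<open>auto simp: mv_carrier\<close>)
qed

text \<open>With only the identity and the full relation available, the kernel for a non-zero
  \<open>e\<close> is full and relates 0 to \<open>u\<close>, which forces \<open>e = u\<close>.
  Conversely, on \<open>{0, u}\<close> a non-identity congruence must relate 0 to
  \<open>u\<close>.\<close>

lemma mv_congruence_simple_iff: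
  "congruence_simple (mv_semiring u) \<longleftrightarrow> card {0..u} = 2"
proof -
  let ?S = "mv_semiring u" and ?I = "Id_on {0..u}" and ?F = "{0..u} \<times> {0..u}"
  have I: "semiring_congruence ?S ?I" and F: "semiring_congruence ?S ?F"
    using semiring_congruence_Id_on[OF semiring_mv_semiring[OF u]]
      semiring_congruence_Times[OF semiring_mv_semiring[OF u]] unfolding mv_carrier .
  have "(0, u) \<in> ?F" "(0, u) \<notin> ?I" using u by (simp_all add: Id_on_iff)
  then have IF: "?I \<noteq> ?F" by metis
  have card_iff: "card {0..u} = 2 \<longleftrightarrow> {0..u} = {0, u}"
  proof
    assume "card {0..u} = 2"
    \<comment> \<open>Finiteness follows because \<open>card\<close> is 0 on infinite sets.\<close>
    then have "finite {0..u}" "card {0, u} = card {0..u}"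
      using u by (simp_all add: card_ge_0_finite)
    then show "{0..u} = {0, u}" using u by (intro card_subset_eq[symmetric]) simp_all
  next
    assume "{0..u} = {0, u}"
    then show "card {0..u} = 2" using card_2_iff less_imp_neq[OF u] by blast
  qed
  show ?thesis
    unfolding card_iff
  proof
    assume "congruence_simple ?S"
    then have card: "card {r. semiring_congruence ?S r} = 2" by (simp add: congruence_simple_def)
    then have "finite {r. semiring_congruence ?S r}" by (simp add: card_ge_0_finite)
    then have all: "{?I, ?F} = {r. semiring_congruence ?S r}"
      using card I F IF by (intro card_subset_eq) simp_all
    have "e = u" if e: "e \<in> {0..u}" "e \<noteq> 0" for e
    proof -
      define K where "K = {(x, y). x \<in> {0..u} \<and> y \<in> {0..u} \<and> sup x e = sup y e}"
      have "K \<in> {?I, ?F}" "K \<noteq> ?I"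
        using semiring_congruence_sup[OF e(1)] semiring_congruence_sup_neq_Id_on[OF e]
        unfolding all K_def mv_carrier by simp_all
      then have "(0, u) \<in> K" using \<open>(0, u) \<in> ?F\<close> by simp
      then have "sup 0 e = sup u e" by (simp add: K_def)
      then show ?thesis using e by (simp add: sup.absorb1 sup.absorb2)
    qed
    then have "{0..u} \<subseteq> {0, u}" by blast
    then show "{0..u} = {0, u}" using u by (intro equalityI) simp_all
  next
    assume two: "{0..u} = {0, u}"
    have "r = ?F" if r: "semiring_congruence ?S r" "r \<noteq> ?I" for r
    proof -
      obtain d where d: "(0, d) \<in> r" "d \<noteq> 0"
        using mv_congruence_zero[OF r(1) r(2)[folded mv_carrier]] .
      have "d = u"
        using semiring_congruence_in_carrier(2)[OF r(1) d(1)] d(2) unfolding mv_carrier two by simp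
      then have "(0, u) \<in> r" "(u, 0) \<in> r" "(0, 0) \<in> r" "(u, u) \<in> r"
        using d(1) semiring_congruence_sym[OF r(1) d(1)] semiring_congruence_refl[OF r(1)] u
        by (simp_all add: mv_carrier)
      then have "?F \<subseteq> r" unfolding two by blast
      then show ?thesis using semiring_congruence_subset[OF r(1)] unfolding mv_carrier by blast
    qed
    then have "{r. semiring_congruence ?S r} = {?I, ?F}" using I F by (intro equalityI subsetI) auto
    then show "congruence_simple ?S" using IF by (simp add: congruence_simple_def)
  qed
qed

lemma mv_total_of_least_nonzero:
  assumes e: "e \<in> {0..u}" "e \<noteq> 0" and least: "\<And>x. x \<in> {0..u} - {0} \<Longrightarrow> e \<le> x"
    and xy: "x \<in> {0..u}" "y \<in> {0..u}"
  shows "x \<le> y \<or> y \<le> x"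
proof (rule ccontr)
  assume incomp: "\<not> (x \<le> y \<or> y \<le> x)"
  define d where "d = inf x y"
  \<comment> \<open>Used for \<open>z = x\<close> and \<open>z = y\<close>: the difference is
    non-zero, and it stays below \<open>z\<close> because \<open>d\<close> is non-negative.\<close>
  have le: "e \<le> z - d" if z: "z \<in> {0..u}" "d \<le> z" "z \<noteq> d" for z
  proof (rule least)
    have "0 \<le> d" using xy by (simp add: d_def)
    then have "z - d \<le> z" using lattice_group_add_left_mono[of 0 d "z - d"] by simp
    moreover have "0 \<le> z - d" using lattice_group_add_right_mono[OF z(2), of "- d"] by simp
    ultimately show "z - d \<in> {0..u} - {0}" using z by auto
  qed
  have "x \<noteq> d" "y \<noteq> d" using incomp by (auto simp: d_def le_iff_inf inf_commute)
  then have "e \<le> inf (x - d) (y - d)" using le xy by (simp add: d_def)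
  \<comment> \<open>Translation by \<open>- d\<close> commutes with the infimum and sends
    \<open>d\<close> to 0.\<close>
  also have "\<dots> = 0" using add_inf_right[of x y "- d"] by (simp add: d_def)
  finally show False using e by auto
qed

end

theorem theorem5p5:
  fixes S :: "'a::lattice_group_add ring" and n :: nat
  assumes "mv_derived S" and "1 \<le> n"
  shows "(subdirectly_irreducible (mat_semiring n S) \<longleftrightarrow>
      (\<exists>e\<in>carrier S. e \<noteq> \<zero>\<^bsub>S\<^esub> \<and> (\<forall>x\<in>carrier S - {\<zero>\<^bsub>S\<^esub>}. e \<le> x)))
    \<and> (congruence_simple (mat_semiring n S) \<longleftrightarrow> card (carrier S) = 2)
    \<and> (subdirectly_irreducible S \<longrightarrow> (\<forall>x\<in>carrier S. \<forall>y\<in>carrier S. x \<le> y \<or> y \<le> x))"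
proof -
  obtain u where u: "0 < u" and S: "S = mv_semiring u"
    using assms(1) by (auto simp: mv_derived_def)
  have semiring: "semiring S" using semiring_mv_semiring[OF u] S by simp
  have zero: "\<zero>\<^bsub>S\<^esub> = 0" and carrier: "carrier S = {0..u}" by (simp_all add: S mv_semiring_def)
  have n: "0 < n" using assms(2) by simp
  have irred: "subdirectly_irreducible S \<longleftrightarrow> (\<exists>e\<in>{0..u}. e \<noteq> 0 \<and> (\<forall>x\<in>{0..u} - {0}. e \<le> x))"
    using mv_subdirectly_irreducible_iff[OF u] S by simp
  show ?thesis
    \<comment> \<open>Both irreducibility statements turn into the existence of a least non-zero
      element, which leaves the cardinality criterion and total order.\<close>
    unfolding subdirectly_irreducible_mat_semiring_iff[OF semiring n]
      congruence_simple_mat_semiring_iff[OF semiring n] zero carrier irred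
    using mv_congruence_simple_iff[OF u] mv_total_of_least_nonzero[OF u] S by blast
qed

end
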